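(* Let $A$ be a commutative unital ring and $V$ the standard comodule on $\mathrm{GL}_{2,A}$. For every odd integer $d=2k+1\ge1$, $$\mathrm{Char}(\mathrm{Sym}^d(V))=\sum_{i=0}^{k}\left(x_2^ix_1^{d-i}+x_2^{d-i}x_1^i\right).$$ For every even integer $d=2k\ge2$, $$\mathrm{Char}(\mathrm{Sym}^d(V))=x_1^kx_2^k+\sum_{i=0}^{k-1}\left(x_1^{d-i}x_2^i+x_1^ix_2^{d-i}\right).$$
   Context: $k[X]$ denotes the coordinate ring of an affine $A$-scheme $X$ (the integer $k$ is unrelated). Let $D=x_{11}x_{22}-x_{12}x_{21}$, $k[G]=A[x_{ij},1/D]$, $\mathrm{GL}_{2,A}=\mathrm{Spec}(k[G])$. The diagonal torus is $T=\mathrm{Spec}(k[T])$ with $k[T]=k[G]/(x_{12},x_{21})=A[t_1^{\pm1},t_2^{\pm1}]$, $t_i$ the class of $x_{ii}$. The standard comodule is the free module $V=A\{e_1,e_2\}$ with $\Delta:V\to k[G]\otimes_A V$, $\Delta(e_1)=x_{11}\otimes e_1+x_{12}\otimes e_2$, $\Delta(e_2)=x_{21}\otimes e_1+x_{22}\otimes e_2$; $\mathrm{Sym}^d(V)$ carries the induced comodule structure $e_1^ae_2^b\mapsto\Delta(e_1)^a\Delta(e_2)^b$, which restricts to a $k[T]$-comodule structure. The character of a $k[T]$-comodule $W$ that is a direct sum of free finite-rank weight spaces is $\mathrm{Char}(W)=\sum_{(a,b)}\mathrm{rank}_A(W_{t_1^at_2^b})\,x_1^ax_2^b$, where $W_\lambda=\{w\in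 W: w\mapsto\lambda\otimes w\}$. *)

theory Defs
  imports Complex_Main "HOL-Library.Poly_Mapping" "HOL-Library.Product_Plus" "HOL-Library.Numeral_Type"
begin

text \<open>
  The base ring \<open>A\<close> is a type \<open>'a\<close> of class \<open>comm_ring_1\<close>. The index set \<open>{1, 2}\<close> is the library
  type \<open>2\<close>, in which the numeral \<open>2\<close> denotes the element \<open>0\<close>, distinct from \<open>1\<close>.
\<close>

section \<open>Free modules, scalar extension, rank\<close>

text \<open>The free module on the set of all elements of \<open>'b\<close> is \<open>'b \<Rightarrow>\<^sub>0 'a\<close>.\<close>

definition pm_scale :: "'a::comm_ring_1 \<Rightarrow> ('b \<Rightarrow>\<^sub>0 'a) \<Rightarrow> ('b \<Rightarrow>\<^sub>0 'a)"
  where "pm_scale a = Poly_Mapping.map ((*) a)"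

lemma lookup_map_0: "f 0 = 0 \<Longrightarrow> Poly_Mapping.lookup (Poly_Mapping.map f p) k = f (Poly_Mapping.lookup p k)"
  by (simp add: Poly_Mapping.map.rep_eq when_def)

lemma lookup_pm_scale [simp]: "Poly_Mapping.lookup (pm_scale a w) k = a * Poly_Mapping.lookup w k"
  by (simp add: pm_scale_def lookup_map_0)

global_interpretation pm: module "pm_scale :: 'a::comm_ring_1 \<Rightarrow> ('b \<Rightarrow>\<^sub>0 'a) \<Rightarrow> ('b \<Rightarrow>\<^sub>0 'a)"
  by unfold_locales (auto intro!: poly_mapping_eqI simp: lookup_add algebra_simps)

definition free_of_rank :: "('b \<Rightarrow>\<^sub>0 'a::comm_ring_1) set \<Rightarrow> nat \<Rightarrow> bool"
  where "free_of_rank W n \<longleftrightarrow> (\<exists>B. finite B \<and> card B = n \<and> \<not> pm.dependent B \<and> pm.span B = W)"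

definition free_rank :: "('b \<Rightarrow>\<^sub>0 'a::comm_ring_1) set \<Rightarrow> nat"
  where "free_rank W = (THE n. free_of_rank W n)"

text \<open>
  For an \<open>A\<close>-algebra \<open>\<eta> : A \<rightarrow> R\<close>, the scalar extension \<open>R \<otimes>\<^sub>A A\<^bsup>(B)\<^esup>\<close> is realised as
  \<open>R\<^bsup>(B)\<^esup>\<close>, with the following pure tensors \<open>r \<otimes> w\<close>; the theorem \<open>pure_tensor_universal\<close> below is
  the universal property of the tensor product. An \<open>A\<close>-submodule \<open>W\<close> of \<open>A\<^bsup>(B)\<^esup>\<close> that is generated
  by part of the basis, or any \<open>W\<close> if \<open>R\<close> is flat, has \<open>R \<otimes>\<^sub>A W\<close> as a submodule of it.
\<close>

definition pure_tensor ::
    "('a::comm_ring_1 \<Rightarrow> 'r::comm_ring_1) \<Rightarrow> 'r \<Rightarrow> ('b \<Rightarrow>\<^sub>0 'a) \<Rightarrow> ('b \<Rightarrow>\<^sub>0 'r)"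
  where "pure_tensor \<eta> r w = Poly_Mapping.map (\<lambda>c. r * \<eta> c) w"

definition ring_hom :: "('r::comm_ring_1 \<Rightarrow> 's::comm_ring_1) \<Rightarrow> bool"
  where "ring_hom f \<longleftrightarrow> f 1 = 1 \<and> (\<forall>x y. f (x + y) = f x + f y) \<and> (\<forall>x y. f (x * y) = f x * f y)"

lemma ring_homD:
  assumes "ring_hom f"
  shows "f 1 = 1" "f (x + y) = f x + f y" "f (x * y) = f x * f y" "f 0 = 0" "f (x - y) = f x - f y"
    "f (x ^ n) = f x ^ n"
proof -
  show 1: "f 1 = 1" "f (x + y) = f x + f y" "f (x * y) = f x * f y" for x y
    using assms unfolding ring_hom_def by auto
  show "f 0 = 0" using 1(2)[of 0 0] by simp
  show "f (x - y) = f x - f y" using 1(2)[of "x - y" y] by simp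
  show "f (x ^ n) = f x ^ n" by (induction n) (simp_all add: 1)
qed

lemma lookup_pure_tensor:
  "\<eta> 0 = 0 \<Longrightarrow> Poly_Mapping.lookup (pure_tensor \<eta> r w) k = r * \<eta> (Poly_Mapping.lookup w k)"
  by (simp add: pure_tensor_def lookup_map_0)

lemma poly_mapping_sum_single: "p = (\<Sum>k\<in>Poly_Mapping.keys p. Poly_Mapping.single k (Poly_Mapping.lookup p k))"
  by (intro poly_mapping_eqI)
     (auto simp: lookup_sum lookup_single when_def sum.If_cases in_keys_iff)

theorem pure_tensor_universal:
  fixes \<eta> :: "'a::comm_ring_1 \<Rightarrow> 'r::comm_ring_1"
    and \<beta> :: "'r \<Rightarrow> ('b \<Rightarrow>\<^sub>0 'a) \<Rightarrow> 'n::ab_group_add"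
  assumes \<eta>: "ring_hom \<eta>"
    and add_l: "\<And>r s w. \<beta> (r + s) w = \<beta> r w + \<beta> s w"
    and add_r: "\<And>r v w. \<beta> r (v + w) = \<beta> r v + \<beta> r w"
    and bal: "\<And>r a w. \<beta> (r * \<eta> a) w = \<beta> r (pm_scale a w)"
  shows "\<exists>!\<phi>. additive \<phi> \<and> (\<forall>r w. \<phi> (pure_tensor \<eta> r w) = \<beta> r w)"
proof -
  note [simp] = ring_homD[OF \<eta>]
  define \<phi> where "\<phi> u = (\<Sum>k\<in>Poly_Mapping.keys u. \<beta> (Poly_Mapping.lookup u k) (Poly_Mapping.single k 1))" for u
  have b0: "\<beta> 0 w = 0" "\<beta> r 0 = 0" for r w
    using add_l[of 0 0 w] add_r[of r 0 0] by auto
  have ext: "\<phi> u = (\<Sum>k\<in>K. \<beta> (Poly_Mapping.lookup u k) (Poly_Mapping.single k 1))" if "finite K" "Poly_Mapping.keys u \<subseteq> K" for u K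
    unfolding \<phi>_def by (rule sum.mono_neutral_left) (use that in \<open>auto simp: in_keys_iff b0\<close>)
  have \<phi>: "additive \<phi>"
  proof
    fix u v :: "'b \<Rightarrow>\<^sub>0 'r"
    define K where "K = Poly_Mapping.keys u \<union> Poly_Mapping.keys v"
    have K: "finite K" "Poly_Mapping.keys u \<subseteq> K" "Poly_Mapping.keys v \<subseteq> K" "Poly_Mapping.keys (u + v) \<subseteq> K"
      using keys_add[of u v] by (auto simp: K_def)
    show "\<phi> (u + v) = \<phi> u + \<phi> v"
      by (simp add: ext[OF K(1) K(2)] ext[OF K(1) K(3)] ext[OF K(1) K(4)] lookup_add add_l sum.distrib)
  qed
  have beta_sum: "\<beta> r (sum f I) = (\<Sum>i\<in>I. \<beta> r (f i))" for r f and I :: "'b set"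
    by (induction I rule: infinite_finite_induct) (auto simp: add_r b0)
  have pure: "\<phi> (pure_tensor \<eta> r w) = \<beta> r w" for r w
  proof -
    have "Poly_Mapping.keys (pure_tensor \<eta> r w) \<subseteq> Poly_Mapping.keys w"
      by (auto simp: in_keys_iff lookup_pure_tensor)
    hence "\<phi> (pure_tensor \<eta> r w) = (\<Sum>k\<in>Poly_Mapping.keys w. \<beta> (r * \<eta> (Poly_Mapping.lookup w k)) (Poly_Mapping.single k 1))"
      by (simp add: ext[of "Poly_Mapping.keys w"] lookup_pure_tensor)
    also have "\<dots> = (\<Sum>k\<in>Poly_Mapping.keys w. \<beta> r (Poly_Mapping.single k (Poly_Mapping.lookup w k)))"
      by (simp add: bal pm_scale_def)
    also have "\<dots> = \<beta> r w"
      by (subst (3) poly_mapping_sum_single) (simp add: beta_sum)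
    finally show ?thesis .
  qed
  have uniq: "\<psi> = \<phi>" if \<psi>: "additive \<psi>" "\<And>r w. \<psi> (pure_tensor \<eta> r w) = \<beta> r w" for \<psi>
  proof
    fix u :: "'b \<Rightarrow>\<^sub>0 'r"
    have s: "Poly_Mapping.single k c = pure_tensor \<eta> c (Poly_Mapping.single k 1)" for k and c :: 'r
      by (intro poly_mapping_eqI) (auto simp: lookup_pure_tensor lookup_single when_def)
    show "\<psi> u = \<phi> u"
      by (subst (1 2) poly_mapping_sum_single)
         (simp add: additive.sum[OF \<psi>(1)] additive.sum[OF \<phi>] s \<psi>(2) pure)
  qed
  show ?thesis
    using \<phi> pure uniq by blast
qed

section \<open>Polynomial rings\<close>

type_synonym ('i, 'a) mpol = "('i \<Rightarrow>\<^sub>0 nat) \<Rightarrow>\<^sub>0 'a"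

definition mpol_const :: "'a::comm_ring_1 \<Rightarrow> ('i, 'a) mpol"
  where "mpol_const a = Poly_Mapping.single 0 a"

definition mpol_var :: "'i \<Rightarrow> ('i, 'a::comm_ring_1) mpol"
  where "mpol_var i = Poly_Mapping.single (Poly_Mapping.single i 1) 1"

text \<open>The extension of a ring homomorphism \<open>\<eta>\<close> on coefficients that sends the variable \<open>i\<close> to \<open>v i\<close>.\<close>

definition mpol_eval ::
    "('a::comm_ring_1 \<Rightarrow> 'r::comm_ring_1) \<Rightarrow> ('i::finite \<Rightarrow> 'r) \<Rightarrow> ('i, 'a) mpol \<Rightarrow> 'r"
  where "mpol_eval \<eta> v p = (\<Sum>m\<in>Poly_Mapping.keys p. \<eta> (Poly_Mapping.lookup p m) * (\<Prod>i\<in>UNIV. v i ^ Poly_Mapping.lookup m i))"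

text \<open>
  The symmetric algebra of the free module \<open>'i \<Rightarrow>\<^sub>0 'a\<close> is the polynomial ring on its basis;
  \<open>sym_incl\<close> is the inclusion in degree one, and \<open>sym_power d\<close> the part of degree \<open>d\<close>. By the
  identification above, \<open>R \<otimes>\<^sub>A Sym(V)\<close> is \<open>('i, 'r) mpol\<close>, as a ring.
\<close>

definition sym_incl :: "('i::finite \<Rightarrow>\<^sub>0 'a::comm_ring_1) \<Rightarrow> ('i, 'a) mpol"
  where "sym_incl v = (\<Sum>i\<in>UNIV. mpol_const (Poly_Mapping.lookup v i) * mpol_var i)"

definition sym_power :: "nat \<Rightarrow> ('i::finite, 'a::comm_ring_1) mpol set"
  where "sym_power d = {p. \<forall>m\<in>Poly_Mapping.keys p. (\<Sum>i\<in>UNIV. Poly_Mapping.lookup m i) = d}"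

lemma ring_hom_mpol_const: "ring_hom (mpol_const :: 'a::comm_ring_1 \<Rightarrow> ('i, 'a) mpol)"
  by (simp add: ring_hom_def mpol_const_def single_add mult_single)

context
  fixes \<eta> :: "'a::comm_ring_1 \<Rightarrow> 'r::comm_ring_1"
  assumes \<eta>: "ring_hom \<eta>"
begin

lemma mpol_eval_add: "mpol_eval \<eta> v (p + q) = mpol_eval \<eta> v p + mpol_eval \<eta> v q"
proof -
  note [simp] = ring_homD[OF \<eta>]
  define K where "K = Poly_Mapping.keys p \<union> Poly_Mapping.keys q"
  have ext: "mpol_eval \<eta> v u = (\<Sum>m\<in>K. \<eta> (Poly_Mapping.lookup u m) * (\<Prod>i\<in>UNIV. v i ^ Poly_Mapping.lookup m i))"
    if "Poly_Mapping.keys u \<subseteq> K" for u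
    unfolding mpol_eval_def
    by (rule sum.mono_neutral_left) (use that in \<open>auto simp: in_keys_iff K_def\<close>)
  have K: "Poly_Mapping.keys p \<subseteq> K" "Poly_Mapping.keys q \<subseteq> K" "Poly_Mapping.keys (p + q) \<subseteq> K"
    using keys_add[of p q] by (auto simp: K_def)
  show ?thesis
    by (simp add: ext[OF K(1)] ext[OF K(2)] ext[OF K(3)] lookup_add sum.distrib distrib_right)
qed

lemma mpol_eval_0 [simp]: "mpol_eval \<eta> v 0 = 0"
  by (simp add: mpol_eval_def)

lemma mpol_eval_single:
  "mpol_eval \<eta> v (Poly_Mapping.single m a) = \<eta> a * (\<Prod>i\<in>UNIV. v i ^ Poly_Mapping.lookup m i)"
  by (cases "a = 0") (simp_all add: mpol_eval_def ring_homD[OF \<eta>])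

lemma mpol_eval_sum: "mpol_eval \<eta> v (sum f I) = (\<Sum>i\<in>I. mpol_eval \<eta> v (f i))"
  by (induction I rule: infinite_finite_induct) (simp_all add: mpol_eval_add)

lemma mpol_eval_mult: "mpol_eval \<eta> v (p * q) = mpol_eval \<eta> v p * mpol_eval \<eta> v q"
proof -
  have s: "mpol_eval \<eta> v (Poly_Mapping.single m a * Poly_Mapping.single n b) =
    mpol_eval \<eta> v (Poly_Mapping.single m a) * mpol_eval \<eta> v (Poly_Mapping.single n b)" for m n a b
    by (simp add: mult_single mpol_eval_single lookup_add power_add prod.distrib ring_homD[OF \<eta>]
        mult_ac)
  have "mpol_eval \<eta> v ((\<Sum>k\<in>Poly_Mapping.keys p. Poly_Mapping.single k (Poly_Mapping.lookup p k)) *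
      (\<Sum>k\<in>Poly_Mapping.keys q. Poly_Mapping.single k (Poly_Mapping.lookup q k))) =
    mpol_eval \<eta> v (\<Sum>k\<in>Poly_Mapping.keys p. Poly_Mapping.single k (Poly_Mapping.lookup p k)) *
    mpol_eval \<eta> v (\<Sum>k\<in>Poly_Mapping.keys q. Poly_Mapping.single k (Poly_Mapping.lookup q k))"
    by (simp only: sum_product mpol_eval_sum s)
  thus ?thesis by (simp only: poly_mapping_sum_single[symmetric])
qed

lemma mpol_eval_const: "mpol_eval \<eta> v (mpol_const a) = \<eta> a"
  by (simp add: mpol_const_def mpol_eval_single)

lemma mpol_eval_var: "mpol_eval \<eta> v (mpol_var i) = v i"
proof -
  have "(\<Prod>j\<in>UNIV. v j ^ Poly_Mapping.lookup (Poly_Mapping.single i (1::nat)) j) = (\<Prod>j\<in>UNIV. if j = i then v j else 1)"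
    by (intro prod.cong) (auto simp: lookup_single when_def)
  thus ?thesis by (simp add: mpol_var_def mpol_eval_single ring_homD[OF \<eta>])
qed

lemma ring_hom_mpol_eval: "ring_hom (mpol_eval \<eta> v)"
  using mpol_eval_const[of v 1]
  by (simp add: ring_hom_def mpol_eval_add mpol_eval_mult mpol_const_def ring_homD[OF \<eta>])

end

lemma sym_power_single [simp]:
  "(\<Sum>i\<in>UNIV. Poly_Mapping.lookup m i) = d \<Longrightarrow> Poly_Mapping.single m a \<in> sym_power d"
  by (auto simp: sym_power_def split: if_splits)

lemma sym_power_0 [simp]: "0 \<in> sym_power d"
  by (simp add: sym_power_def)

lemma sym_power_add: "p \<in> sym_power d \<Longrightarrow> q \<in> sym_power d \<Longrightarrow> p + q \<in> sym_power d"
  using keys_add[of p q] by (auto simp: sym_power_def)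

lemma sym_power_sum: "(\<And>i. i \<in> I \<Longrightarrow> f i \<in> sym_power d) \<Longrightarrow> sum f I \<in> sym_power d"
  by (induction I rule: infinite_finite_induct) (auto intro: sym_power_add)

lemma sym_power_mult: "p \<in> sym_power d \<Longrightarrow> q \<in> sym_power e \<Longrightarrow> p * q \<in> sym_power (d + e)"
  using keys_mult[of p q] by (force simp: sym_power_def lookup_add sum.distrib)

lemma sym_power_1: "1 \<in> sym_power 0"
  by (simp add: sym_power_def)

lemma sym_power_power: "p \<in> sym_power d \<Longrightarrow> p ^ n \<in> sym_power (n * d)"
  by (induction n) (auto intro: sym_power_mult sym_power_1)

lemma sym_power_prod:
  "(\<And>i. i \<in> I \<Longrightarrow> f i \<in> sym_power (d i)) \<Longrightarrow> finite I \<Longrightarrow> prod f I \<in> sym_power (sum d I)"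
  by (induction I rule: infinite_finite_induct) (auto intro: sym_power_mult sym_power_1)

section \<open>The coordinate ring of the general linear group\<close>

text \<open>\<open>A[x\<^sub>i\<^sub>j, 1/D]\<close> is the localization of \<open>A[x\<^sub>i\<^sub>j]\<close> at the powers of \<open>D\<close>; the pair \<open>(p, n)\<close>
  represents \<open>p/D\<^sup>n\<close>.\<close>

definition mat_det :: "(2 \<times> 2, 'a::comm_ring_1) mpol"
  where "mat_det = mpol_var (1, 1) * mpol_var (2, 2) - mpol_var (1, 2) * mpol_var (2, 1)"

definition gl2_rel :: "(2 \<times> 2, 'a::comm_ring_1) mpol \<times> nat \<Rightarrow> (2 \<times> 2, 'a) mpol \<times> nat \<Rightarrow> bool"
  where "gl2_rel = (\<lambda>(p, m) (q, n). \<exists>k. mat_det ^ k * (p * mat_det ^ n) = mat_det ^ k * (q * mat_det ^ m))"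

lemma equivp_gl2_rel: "equivp (gl2_rel :: (2 \<times> 2, 'a::comm_ring_1) mpol \<times> nat \<Rightarrow> _)"
proof (rule equivpI)
  show "reflp (gl2_rel :: (2 \<times> 2, 'a) mpol \<times> nat \<Rightarrow> _)"
    by (auto simp: reflp_def gl2_rel_def)
  show "symp (gl2_rel :: (2 \<times> 2, 'a) mpol \<times> nat \<Rightarrow> _)"
    by (auto simp: symp_def gl2_rel_def) metis
  show "transp (gl2_rel :: (2 \<times> 2, 'a) mpol \<times> nat \<Rightarrow> _)"
  proof (rule transpI, clarsimp simp: gl2_rel_def)
    fix p q r :: "(2 \<times> 2, 'a) mpol" and m n l k j
    let ?D = "mat_det :: (2 \<times> 2, 'a) mpol"
    assume 1: "?D ^ k * (p * ?D ^ n) = ?D ^ k * (q * ?D ^ m)"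
      and 2: "?D ^ j * (q * ?D ^ l) = ?D ^ j * (r * ?D ^ n)"
    have "?D ^ (k + j + n) * (p * ?D ^ l) = ?D ^ j * ?D ^ l * (?D ^ k * (p * ?D ^ n))"
      by (simp add: power_add mult_ac)
    also have "\<dots> = ?D ^ k * ?D ^ m * (?D ^ j * (q * ?D ^ l))"
      unfolding 1 by (simp add: mult_ac)
    also have "\<dots> = ?D ^ (k + j + n) * (r * ?D ^ m)"
      unfolding 2 by (simp add: power_add mult_ac)
    finally show "\<exists>k. ?D ^ k * (p * ?D ^ l) = ?D ^ k * (r * ?D ^ m)" by blast
  qed
qed

lifting_forget poly_mapping.lifting

quotient_type (overloaded) 'a gl2_ring = "(2 \<times> 2, 'a::comm_ring_1) mpol \<times> nat" / gl2_rel
  by (rule equivp_gl2_rel)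

instantiation gl2_ring :: (comm_ring_1) comm_ring_1
begin

lift_definition zero_gl2_ring :: "'a gl2_ring" is "(0, 0)" .

lift_definition one_gl2_ring :: "'a gl2_ring" is "(1, 0)" .

lift_definition plus_gl2_ring :: "'a gl2_ring \<Rightarrow> 'a gl2_ring \<Rightarrow> 'a gl2_ring"
  is "\<lambda>(p, m) (q, n). (p * mat_det ^ n + q * mat_det ^ m, m + n)"
proof (clarsimp simp: gl2_rel_def)
  fix p p' q q' :: "(2 \<times> 2, 'a) mpol" and m m' n n' k j
  let ?D = "mat_det :: (2 \<times> 2, 'a) mpol"
  assume 1: "?D ^ k * (p * ?D ^ m') = ?D ^ k * (p' * ?D ^ m)"
    and 2: "?D ^ j * (q * ?D ^ n') = ?D ^ j * (q' * ?D ^ n)"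
  have "?D ^ (k + j) * ((p * ?D ^ n + q * ?D ^ m) * ?D ^ (m' + n')) =
      ?D ^ j * ?D ^ n * ?D ^ n' * (?D ^ k * (p * ?D ^ m')) + ?D ^ k * ?D ^ m * ?D ^ m' * (?D ^ j * (q * ?D ^ n'))"
    by (simp add: power_add algebra_simps)
  also have "\<dots> = ?D ^ (k + j) * ((p' * ?D ^ n' + q' * ?D ^ m') * ?D ^ (m + n))"
    unfolding 1 2 by (simp add: power_add algebra_simps)
  finally show "\<exists>k. ?D ^ k * ((p * ?D ^ n + q * ?D ^ m) * ?D ^ (m' + n')) =
      ?D ^ k * ((p' * ?D ^ n' + q' * ?D ^ m') * ?D ^ (m + n))" by blast
qed

lift_definition times_gl2_ring :: "'a gl2_ring \<Rightarrow> 'a gl2_ring \<Rightarrow> 'a gl2_ring"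
  is "\<lambda>(p, m) (q, n). (p * q, m + n)"
proof (clarsimp simp: gl2_rel_def)
  fix p p' q q' :: "(2 \<times> 2, 'a) mpol" and m m' n n' k j
  let ?D = "mat_det :: (2 \<times> 2, 'a) mpol"
  assume 1: "?D ^ k * (p * ?D ^ m') = ?D ^ k * (p' * ?D ^ m)"
    and 2: "?D ^ j * (q * ?D ^ n') = ?D ^ j * (q' * ?D ^ n)"
  have "?D ^ (k + j) * (p * q * ?D ^ (m' + n')) = (?D ^ k * (p * ?D ^ m')) * (?D ^ j * (q * ?D ^ n'))"
    by (simp add: power_add mult_ac)
  also have "\<dots> = ?D ^ (k + j) * (p' * q' * ?D ^ (m + n))"
    unfolding 1 2 by (simp add: power_add mult_ac)
  finally show "\<exists>k. ?D ^ k * (p * q * ?D ^ (m' + n')) = ?D ^ k * (p' * q' * ?D ^ (m + n))" by blast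
qed

lift_definition uminus_gl2_ring :: "'a gl2_ring \<Rightarrow> 'a gl2_ring" is "\<lambda>(p, m). (- p, m)"
  by (auto simp: gl2_rel_def)

definition minus_gl2_ring :: "'a gl2_ring \<Rightarrow> 'a gl2_ring \<Rightarrow> 'a gl2_ring"
  where "minus_gl2_ring x y = x + - y"

instance
proof
  fix a b c :: "'a gl2_ring"
  show "a * b * c = a * (b * c)" by transfer (auto simp: gl2_rel_def mult_ac add_ac)
  show "a * b = b * a" by transfer (auto simp: gl2_rel_def mult_ac add_ac)
  show "1 * a = a" by transfer (auto simp: gl2_rel_def)
  show "a + b + c = a + (b + c)" by transfer (auto simp: gl2_rel_def algebra_simps power_add)
  show "a + b = b + a" by transfer (auto simp: gl2_rel_def algebra_simps)
  show "0 + a = a" by transfer (auto simp: gl2_rel_def)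
  show "- a + a = 0" by transfer (auto simp: gl2_rel_def)
  show "a - b = a + - b" by (simp add: minus_gl2_ring_def)
  show "(a + b) * c = a * c + b * c" by transfer (auto simp: gl2_rel_def algebra_simps power_add)
  have "\<not> gl2_rel (0, 0) ((1, 0) :: (2 \<times> 2, 'a) mpol \<times> nat)"
  proof
    assume "gl2_rel (0, 0) ((1, 0) :: (2 \<times> 2, 'a) mpol \<times> nat)"
    then obtain k where k: "(mat_det :: (2 \<times> 2, 'a) mpol) ^ k = 0"
      by (auto simp: gl2_rel_def)
    define v :: "2 \<times> 2 \<Rightarrow> 'a" where "v = (\<lambda>(i, j). if i = j then 1 else 0)"
    have id: "ring_hom (\<lambda>x::'a. x)" by (simp add: ring_hom_def)
    note ev = ring_hom_mpol_eval[OF id, of v]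
    have "mpol_eval (\<lambda>x::'a. x) v mat_det = 1"
      unfolding mat_det_def ring_homD[OF ev] mpol_eval_var[OF id] by (simp add: v_def)
    moreover have "mpol_eval (\<lambda>x::'a. x) v (mat_det ^ k) = 0"
      using k ring_homD(4)[OF ev] by simp
    ultimately show False by (simp add: ring_homD(6)[OF ev])
  qed
  thus "(0 :: 'a gl2_ring) \<noteq> 1" by transfer
qed

end

lift_definition gl2_frac :: "(2 \<times> 2, 'a::comm_ring_1) mpol \<Rightarrow> nat \<Rightarrow> 'a gl2_ring"
  is "\<lambda>p n. (p, n)" .

lemma gl2_frac_mult: "gl2_frac p m * gl2_frac q n = gl2_frac (p * q) (m + n)"
  by transfer (simp add: gl2_rel_def)

lemma gl2_frac_add: "gl2_frac p n + gl2_frac q n = gl2_frac (p + q) n"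
proof (transfer, unfold gl2_rel_def prod.case)
  fix p q :: "(2 \<times> 2, 'a) mpol" and n
  have "(p * mat_det ^ n + q * mat_det ^ n) * mat_det ^ n = (p + q) * mat_det ^ (n + n)"
    by (simp add: power_add distrib_right mult.assoc)
  thus "\<exists>k. mat_det ^ k * ((p * mat_det ^ n + q * mat_det ^ n) * mat_det ^ n) =
      mat_det ^ k * ((p + q) * mat_det ^ (n + n))" by simp
qed

definition gl2_const :: "'a::comm_ring_1 \<Rightarrow> 'a gl2_ring"
  where "gl2_const a = gl2_frac (mpol_const a) 0"

definition gl2_x :: "2 \<Rightarrow> 2 \<Rightarrow> 'a::comm_ring_1 gl2_ring"
  where "gl2_x i j = gl2_frac (mpol_var (i, j)) 0"

lemma ring_hom_gl2_const: "ring_hom gl2_const"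
  unfolding ring_hom_def gl2_const_def
  by (intro conjI allI; transfer)
     (auto simp: gl2_rel_def ring_homD[OF ring_hom_mpol_const])

section \<open>The diagonal torus\<close>

text \<open>\<open>A[t\<^sub>1\<^sup>\<plusminus>\<^sup>1, t\<^sub>2\<^sup>\<plusminus>\<^sup>1]\<close>; the monomial \<open>t\<^sub>1\<^sup>a t\<^sub>2\<^sup>b\<close> is \<open>single (a, b) 1\<close>.\<close>

type_synonym 'a torus_ring = "(int \<times> int) \<Rightarrow>\<^sub>0 'a"

definition torus_const :: "'a::comm_ring_1 \<Rightarrow> 'a torus_ring"
  where "torus_const a = Poly_Mapping.single 0 a"

definition torus_char :: "int \<times> int \<Rightarrow> 'a::comm_ring_1 torus_ring"
  where "torus_char \<mu> = Poly_Mapping.single \<mu> 1"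

definition torus_t :: "2 \<Rightarrow> 'a::comm_ring_1 torus_ring"
  where "torus_t i = torus_char (if i = 1 then (1, 0) else (0, 1))"

lemma ring_hom_torus_const: "ring_hom (torus_const :: 'a::comm_ring_1 \<Rightarrow> 'a torus_ring)"
  by (simp add: ring_hom_def torus_const_def single_add mult_single)

definition diag_eval :: "(2 \<times> 2, 'a::comm_ring_1) mpol \<Rightarrow> 'a torus_ring"
  where "diag_eval = mpol_eval torus_const (\<lambda>(i, j). if i = j then torus_t i else 0)"

lemma ring_hom_diag_eval: "ring_hom (diag_eval :: _ \<Rightarrow> 'a::comm_ring_1 torus_ring)"
  unfolding diag_eval_def by (rule ring_hom_mpol_eval[OF ring_hom_torus_const])

lemma diag_eval_var: "diag_eval (mpol_var (i, j)) = (if i = j then torus_t i else 0)"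
  by (simp add: diag_eval_def mpol_eval_var[OF ring_hom_torus_const])

lemma torus_char_mult: "torus_char \<mu> * torus_char \<nu> = torus_char (\<mu> + \<nu>)"
  by (simp add: torus_char_def mult_single)

lemma torus_char_0: "torus_char 0 = 1"
  by (simp add: torus_char_def)

lemma torus_char_power: "torus_char (a, b) ^ n = torus_char (int n * a, int n * b)"
  by (induction n) (simp_all add: torus_char_mult zero_prod_def[symmetric] torus_char_0 algebra_simps)

lemma diag_eval_det_power: "diag_eval (mat_det ^ n) = (torus_char (int n, int n) :: 'a::comm_ring_1 torus_ring)"
proof -
  have "diag_eval mat_det = (torus_char (1, 1) :: 'a torus_ring)"
    unfolding mat_det_def ring_homD[OF ring_hom_diag_eval] diag_eval_var
    by (simp add: torus_t_def torus_char_mult)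
  thus ?thesis by (simp add: ring_homD(6)[OF ring_hom_diag_eval] torus_char_power)
qed

text \<open>The homomorphism \<open>k[G] \<rightarrow> k[T]\<close> over \<open>A\<close> with \<open>x\<^sub>i\<^sub>i \<mapsto> t\<^sub>i\<close>, \<open>x\<^sub>1\<^sub>2, x\<^sub>2\<^sub>1 \<mapsto> 0\<close>. The theorems
  \<open>surj_torus_restrict\<close> and \<open>kernel_torus_restrict\<close> identify \<open>k[T]\<close> with \<open>k[G]/(x\<^sub>1\<^sub>2, x\<^sub>2\<^sub>1)\<close>.\<close>

lift_definition torus_restrict :: "'a::comm_ring_1 gl2_ring \<Rightarrow> 'a torus_ring"
  is "\<lambda>(p, n). diag_eval p * torus_char (- int n, - int n)"
proof (clarsimp simp: gl2_rel_def)
  fix p q :: "(2 \<times> 2, 'a) mpol" and m n k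
  assume "mat_det ^ k * (p * mat_det ^ n) = mat_det ^ k * (q * mat_det ^ m)"
  hence "diag_eval (mat_det ^ k * (p * mat_det ^ n)) = diag_eval (mat_det ^ k * (q * mat_det ^ m))"
    by simp
  hence "torus_char (int k, int k) * (diag_eval p * torus_char (int n, int n)) =
      torus_char (int k, int k) * (diag_eval q * torus_char (int m, int m))" (is "?l = ?r")
    by (simp only: ring_homD(3)[OF ring_hom_diag_eval] diag_eval_det_power)
  hence "torus_char (- int k - int m - int n, - int k - int m - int n) * ?l =
    torus_char (- int k - int m - int n, - int k - int m - int n) * ?r" by simp
  moreover have "torus_char (- int k - int m - int n, - int k - int m - int n) * ?l =
      diag_eval p * (torus_char (- int k - int m - int n, - int k - int m - int n) *
        torus_char (int k, int k) * torus_char (int n, int n))"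
    by (simp only: mult_ac)
  moreover have "torus_char (- int k - int m - int n, - int k - int m - int n) * ?r =
      diag_eval q * (torus_char (- int k - int m - int n, - int k - int m - int n) *
        torus_char (int k, int k) * torus_char (int m, int m))"
    by (simp only: mult_ac)
  ultimately show "diag_eval p * torus_char (- int m, - int m) = diag_eval q * torus_char (- int n, - int n)"
    by (simp add: torus_char_mult)
qed

lemma torus_restrict_frac:
  "torus_restrict (gl2_frac p n) = diag_eval p * torus_char (- int n, - int n)"
  by transfer simp

lemma ring_hom_torus_restrict: "ring_hom (torus_restrict :: 'a::comm_ring_1 gl2_ring \<Rightarrow> _)"
proof -
  note [simp] = ring_homD[OF ring_hom_diag_eval]
  have z: "torus_char (0, 0) = (1 :: 'a torus_ring)"
    using torus_char_0 by (simp add: zero_prod_def)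
  have "torus_restrict (x + y) = torus_restrict x + torus_restrict y" for x y :: "'a gl2_ring"
  proof (transfer, clarsimp)
    fix p q :: "(2 \<times> 2, 'a) mpol" and m n
    have "torus_char (int n, int n) * torus_char (- int m - int n, - int m - int n) = (torus_char (- int m, - int m) :: 'a torus_ring)"
      "torus_char (int m, int m) * torus_char (- int m - int n, - int m - int n) = (torus_char (- int n, - int n) :: 'a torus_ring)"
      by (simp_all add: torus_char_mult)
    thus "(diag_eval p * diag_eval mat_det ^ n + diag_eval q * diag_eval mat_det ^ m) *
        torus_char (- int m - int n, - int m - int n) =
      diag_eval p * torus_char (- int m, - int m) + diag_eval q * torus_char (- int n, - int n)"
      by (simp add: diag_eval_det_power[unfolded ring_homD[OF ring_hom_diag_eval]] distrib_right mult.assoc)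
  qed
  moreover have "torus_restrict (x * y) = torus_restrict x * torus_restrict y" for x y :: "'a gl2_ring"
  proof (transfer, clarsimp)
    fix p q :: "(2 \<times> 2, 'a) mpol" and m n
    have "torus_char (- int m - int n, - int m - int n) =
      (torus_char (- int m, - int m) * torus_char (- int n, - int n) :: 'a torus_ring)"
      by (simp add: torus_char_mult)
    thus "diag_eval p * diag_eval q * torus_char (- int m - int n, - int m - int n) =
      diag_eval p * torus_char (- int m, - int m) * (diag_eval q * torus_char (- int n, - int n))"
      by (simp add: mult_ac)
  qed
  moreover have "torus_restrict 1 = (1 :: 'a torus_ring)"
    by transfer (simp add: z)
  ultimately show ?thesis by (simp add: ring_hom_def)
qed

theorem torus_restrict_gl2:
  "torus_restrict (gl2_const a) = torus_const (a :: 'a::comm_ring_1)"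
  "torus_restrict (gl2_x i j) = (if i = j then torus_t i else 0 :: 'a torus_ring)"
proof -
  have z: "torus_char (0, 0) = (1 :: 'a torus_ring)"
    using torus_char_0 by (simp add: zero_prod_def)
  show "torus_restrict (gl2_const a) = torus_const a"
    by (simp add: gl2_const_def torus_restrict_frac diag_eval_def z
        mpol_eval_const[OF ring_hom_torus_const])
  show "torus_restrict (gl2_x i j) = (if i = j then torus_t i else 0 :: 'a torus_ring)"
    by (simp add: gl2_x_def torus_restrict_frac diag_eval_var z)
qed


lemma UNIV_2: "(UNIV :: 2 set) = {1, 2}"
proof -
  have "card {1, 2 :: 2} = CARD(2)" by simp
  thus ?thesis by (metis card_subset_eq finite subset_UNIV)
qed

lemma UNIV_2x2: "(UNIV :: (2 \<times> 2) set) = {(1, 1), (1, 2), (2, 1), (2, 2)}"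
  unfolding UNIV_Times_UNIV[symmetric] UNIV_2 by auto

theorem surj_torus_restrict: "surj (torus_restrict :: 'a::comm_ring_1 gl2_ring \<Rightarrow> _)"
proof -
  note hom = ring_homD[OF ring_hom_torus_restrict] 
  have s: "Poly_Mapping.single \<mu> c \<in> range torus_restrict" for \<mu> and c :: 'a
  proof (cases \<mu>)
    case (Pair a b)
    define N where "N = nat \<bar>a\<bar> + nat \<bar>b\<bar>"
    let ?p = "mpol_const c * mpol_var (1, 1) ^ nat (a + N) * mpol_var (2, 2) ^ nat (b + N)"
    have N: "a + int N \<ge> 0" "b + int N \<ge> 0" by (auto simp: N_def)
    have "diag_eval ?p = torus_const c * torus_char (a + N, 0) * torus_char (0, b + N)"
      using N by (simp add: ring_homD[OF ring_hom_diag_eval] diag_eval_var torus_t_def torus_char_power)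
        (simp add: diag_eval_def mpol_eval_const[OF ring_hom_torus_const])
    hence "torus_restrict (gl2_frac ?p N) = Poly_Mapping.single \<mu> c"
      using Pair by (simp add: torus_restrict_frac mult.assoc torus_char_mult)
        (simp add: torus_const_def torus_char_def mult_single zero_prod_def[symmetric])
    thus ?thesis by (metis rangeI)
  qed
  have z: "0 \<in> range (torus_restrict :: 'a gl2_ring \<Rightarrow> _)"
    by (rule range_eqI[of _ _ 0]) (simp add: hom)
  have sum_in: "sum f I \<in> range torus_restrict" if "\<And>i. i \<in> I \<Longrightarrow> f i \<in> range torus_restrict"
    for f :: "int \<times> int \<Rightarrow> 'a torus_ring" and I
    using that
  proof (induction I rule: infinite_finite_induct)
    case (insert i I)
    have "sum f I \<in> range torus_restrict" by (rule insert.IH) (rule insert.prems, simp)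
    then obtain y where y: "sum f I = torus_restrict y" by blast
    obtain x where x: "f i = torus_restrict x" using insert.prems[of i] by blast
    have "sum f (insert i I) = torus_restrict (x + y)"
      unfolding sum.insert[OF insert.hyps] x y hom(2) ..
    thus ?case by (rule range_eqI)
  qed (simp_all only: sum.infinite sum.empty z not_False_eq_True)
  have "y \<in> range torus_restrict" for y :: "'a torus_ring"
  proof -
    have "(\<Sum>k\<in>Poly_Mapping.keys y. Poly_Mapping.single k (Poly_Mapping.lookup y k)) \<in> range torus_restrict"
      by (rule sum_in) (rule s)
    thus "y \<in> range torus_restrict" by (simp only: poly_mapping_sum_single[symmetric])
  qed
  thus ?thesis by blast
qed

lemma diag_decomposition:
  fixes p :: "(2 \<times> 2, 'a::comm_ring_1) mpol"
  shows "\<exists>a b r. p = a * mpol_var (1, 2) + b * mpol_var (2, 1) + r \<and>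
    (\<forall>m\<in>Poly_Mapping.keys r. Poly_Mapping.lookup m (1, 2) = 0 \<and> Poly_Mapping.lookup m (2, 1) = 0)"
    (is "?P p")
proof -
  have z: "?P 0" by (rule exI[of _ 0])+ simp
  have add: "?P (p + q)" if p: "?P p" and q: "?P q" for p q
  proof -
    obtain a b r where 1: "p = a * mpol_var (1, 2) + b * mpol_var (2, 1) + r"
      "\<forall>m\<in>Poly_Mapping.keys r. Poly_Mapping.lookup m (1, 2) = 0 \<and> Poly_Mapping.lookup m (2, 1) = 0"
      using p by blast
    obtain a' b' r' where 2: "q = a' * mpol_var (1, 2) + b' * mpol_var (2, 1) + r'"
      "\<forall>m\<in>Poly_Mapping.keys r'. Poly_Mapping.lookup m (1, 2) = 0 \<and> Poly_Mapping.lookup m (2, 1) = 0"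
      using q by blast
    have "p + q = (a + a') * mpol_var (1, 2) + (b + b') * mpol_var (2, 1) + (r + r')"
      by (simp add: 1 2 algebra_simps)
    moreover have "\<forall>m\<in>Poly_Mapping.keys (r + r'). Poly_Mapping.lookup m (1, 2) = 0 \<and> Poly_Mapping.lookup m (2, 1) = 0"
      using keys_add[of r r'] 1(2) 2(2) by blast
    ultimately show ?thesis by blast
  qed
  have sub: "\<exists>q :: (2 \<times> 2, 'a) mpol. Poly_Mapping.single m c = q * mpol_var ij" if "Poly_Mapping.lookup m ij \<noteq> 0" 
    for m ij and c :: 'a
  proof
    have "m = (m - Poly_Mapping.single ij 1) + Poly_Mapping.single ij 1"
      using that by (intro poly_mapping_eqI) (auto simp: lookup_add lookup_minus lookup_single when_def)
    thus "Poly_Mapping.single m c = Poly_Mapping.single (m - Poly_Mapping.single ij 1) c * mpol_var ij"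
      by (simp add: mpol_var_def mult_single)
  qed
  have s: "?P (Poly_Mapping.single m c)" for m and c :: 'a
  proof -
    consider "Poly_Mapping.lookup m (1, 2) \<noteq> 0" | "Poly_Mapping.lookup m (2, 1) \<noteq> 0"
      | "Poly_Mapping.lookup m (1, 2) = 0 \<and> Poly_Mapping.lookup m (2, 1) = 0" by metis
    thus ?thesis
    proof cases
      case 1
      then obtain q where "Poly_Mapping.single m c = q * mpol_var (1, 2)" using sub by blast
      thus ?thesis by - (rule exI[of _ q], rule exI[of _ 0], rule exI[of _ 0], simp)
    next
      case 2
      then obtain q where "Poly_Mapping.single m c = q * mpol_var (2, 1)" using sub by blast
      thus ?thesis by - (rule exI[of _ 0], rule exI[of _ q], rule exI[of _ 0], simp)
    next
      case 3
      thus ?thesis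
        by - (rule exI[of _ 0], rule exI[of _ 0], rule exI[of _ "Poly_Mapping.single m c"],
          auto split: if_splits)
    qed
  qed
  have "?P (sum f I)" if "\<And>i. ?P (f i)" for f :: "_ \<Rightarrow> (2 \<times> 2, 'a) mpol" and I :: "((2 \<times> 2) \<Rightarrow>\<^sub>0 nat) set"
  proof (induction I rule: infinite_finite_induct)
    case (insert i I)
    show ?case unfolding sum.insert[OF insert(1,2)] by (rule add[OF that insert(3)])
  next
    case (infinite I)
    show ?case unfolding sum.infinite[OF infinite] by (rule z)
  next
    case empty
    show ?case unfolding sum.empty by (rule z)
  qed
  from this[of "\<lambda>m. Poly_Mapping.single m (Poly_Mapping.lookup p m)" "Poly_Mapping.keys p", OF s]
  show ?thesis by (simp only: poly_mapping_sum_single[symmetric])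
qed

theorem kernel_torus_restrict:
  "torus_restrict x = 0 \<longleftrightarrow> (\<exists>a b. x = a * gl2_x 1 2 + b * gl2_x 2 1)"
  for x :: "'a::comm_ring_1 gl2_ring"
proof
  assume "\<exists>a b. x = a * gl2_x 1 2 + b * gl2_x 2 1"
  thus "torus_restrict x = 0"
    by (auto simp: ring_homD[OF ring_hom_torus_restrict] torus_restrict_gl2)
next
  assume x: "torus_restrict x = 0"
  have "\<exists>p n. x = gl2_frac p n" by transfer (auto simp: gl2_rel_def)
  then obtain p n where pn: "x = gl2_frac p n" by blast
  obtain a b r where 1: "p = a * mpol_var (1, 2) + b * mpol_var (2, 1) + r"
    and r: "\<And>m. m \<in> Poly_Mapping.keys r \<Longrightarrow> Poly_Mapping.lookup m (1, 2) = 0 \<and> Poly_Mapping.lookup m (2, 1) = 0"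
    using diag_decomposition[of p] by blast
  let ?w = "\<lambda>m. (int (Poly_Mapping.lookup m (1 :: 2, 1 :: 2)), int (Poly_Mapping.lookup m (2, 2)))"
  have inj: "inj_on ?w (Poly_Mapping.keys r)"
  proof (rule inj_onI)
    fix m m' assume m: "m \<in> Poly_Mapping.keys r" "m' \<in> Poly_Mapping.keys r" "?w m = ?w m'"
    have "\<forall>ij\<in>UNIV. Poly_Mapping.lookup m ij = Poly_Mapping.lookup m' ij"
      unfolding UNIV_2x2 using r[OF m(1)] r[OF m(2)] m(3) by simp
    thus "m = m'" by (metis UNIV_I poly_mapping_eqI)
  qed
  have "diag_eval p * (torus_char (- int n, - int n) * torus_char (int n, int n)) = 0"
    using x by (simp add: pn torus_restrict_frac flip: mult.assoc)
  hence "diag_eval p = 0"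
    using torus_char_0[where 'a = 'a] by (simp add: torus_char_mult zero_prod_def)
  hence "diag_eval r = 0"
    by (simp add: 1 ring_homD[OF ring_hom_diag_eval] diag_eval_var)
  moreover have "diag_eval r = (\<Sum>m\<in>Poly_Mapping.keys r. Poly_Mapping.single (?w m) (Poly_Mapping.lookup r m))"
    unfolding diag_eval_def mpol_eval_def
  proof (rule sum.cong[OF refl])
    fix m assume m: "m \<in> Poly_Mapping.keys r"
    have "(\<Prod>i\<in>UNIV. (case i of (i, j) \<Rightarrow> if i = j then torus_t i else 0) ^ Poly_Mapping.lookup m i) =
      (torus_char (?w m) :: 'a torus_ring)"
      unfolding UNIV_2x2 using r[OF m]
      by (simp add: torus_t_def torus_char_power torus_char_mult)
    thus "torus_const (Poly_Mapping.lookup r m) *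
        (\<Prod>i\<in>UNIV. (case i of (i, j) \<Rightarrow> if i = j then torus_t i else 0) ^ Poly_Mapping.lookup m i) =
      Poly_Mapping.single (?w m) (Poly_Mapping.lookup r m)"
      by (simp add: torus_const_def torus_char_def mult_single)
  qed
  ultimately have s: "(\<Sum>m\<in>Poly_Mapping.keys r. Poly_Mapping.single (?w m) (Poly_Mapping.lookup r m)) = 0"
    by simp
  have "Poly_Mapping.keys r = {}"
  proof (rule ccontr)
    assume "Poly_Mapping.keys r \<noteq> {}"
    then obtain m where m: "m \<in> Poly_Mapping.keys r" by blast
    have "0 = Poly_Mapping.lookup (\<Sum>m\<in>Poly_Mapping.keys r. Poly_Mapping.single (?w m) (Poly_Mapping.lookup r m)) (?w m)"
      unfolding s by simp
    also have "\<dots> = (\<Sum>m'\<in>Poly_Mapping.keys r. if m' = m then Poly_Mapping.lookup r m' else 0)"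
      unfolding lookup_sum lookup_single when_def
      by (rule sum.cong) (use inj m in \<open>auto simp: inj_on_def\<close>)
    also have "\<dots> = Poly_Mapping.lookup r m" using m by simp
    finally show False using m by (simp add: in_keys_iff)
  qed
  hence "p = a * mpol_var (1, 2) + b * mpol_var (2, 1)" using 1 by simp
  hence "x = gl2_frac a n * gl2_x 1 2 + gl2_frac b n * gl2_x 2 1"
    by (simp add: pn gl2_x_def gl2_frac_mult gl2_frac_add)
  thus "\<exists>a b. x = a * gl2_x 1 2 + b * gl2_x 2 1" by blast
qed

section \<open>The standard comodule and its symmetric powers\<close>

definition std_e :: "2 \<Rightarrow> (2 \<Rightarrow>\<^sub>0 'a::comm_ring_1)"
  where "std_e i = Poly_Mapping.single i 1"

text \<open>The linear extension of \<open>\<Delta>(e\<^sub>i) = x\<^sub>i\<^sub>1 \<otimes> e\<^sub>1 + x\<^sub>i\<^sub>2 \<otimes> e\<^sub>2\<close>.\<close>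

definition std_coaction :: "(2 \<Rightarrow>\<^sub>0 'a::comm_ring_1) \<Rightarrow> (2 \<Rightarrow>\<^sub>0 'a gl2_ring)"
  where "std_coaction v = (\<Sum>i\<in>UNIV. pm_scale (gl2_const (Poly_Mapping.lookup v i))
    (pure_tensor gl2_const (gl2_x i 1) (std_e 1) + pure_tensor gl2_const (gl2_x i 2) (std_e 2)))"

text \<open>The \<open>A\<close>-algebra homomorphism \<open>Sym(V) \<rightarrow> k[G] \<otimes>\<^sub>A Sym(V)\<close> that extends \<open>std_coaction\<close>.\<close>

definition sym_coaction :: "(2, 'a::comm_ring_1) mpol \<Rightarrow> (2, 'a gl2_ring) mpol"
  where "sym_coaction =
    mpol_eval (\<lambda>a. mpol_const (gl2_const a)) (\<lambda>i. sym_incl (std_coaction (std_e i)))"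

text \<open>\<open>Poly_Mapping.map torus_restrict\<close> is the base change of \<open>k[G] \<rightarrow> k[T]\<close>.\<close>

definition sym_torus_coaction :: "(2, 'a::comm_ring_1) mpol \<Rightarrow> (2, 'a torus_ring) mpol"
  where "sym_torus_coaction w = Poly_Mapping.map torus_restrict (sym_coaction w)"

lemma map_torus_restrict_pure_tensor:
  "Poly_Mapping.map torus_restrict (pure_tensor gl2_const r w) = pure_tensor torus_const (torus_restrict r) w"
  by (intro poly_mapping_eqI)
     (simp add: lookup_map_0 lookup_pure_tensor ring_homD[OF ring_hom_torus_restrict]
       ring_homD[OF ring_hom_gl2_const] ring_homD[OF ring_hom_torus_const] torus_restrict_gl2)

lemma std_coaction_std_e:
  "std_coaction (std_e i) =
    pure_tensor gl2_const (gl2_x i 1) (std_e 1) + pure_tensor gl2_const (gl2_x i 2) (std_e 2)"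
  (is "_ = ?t i")
proof -
  have "std_coaction (std_e i) = (\<Sum>j\<in>UNIV. if j = i then ?t j else 0)"
    unfolding std_coaction_def
    by (rule sum.cong)
       (auto simp: std_e_def lookup_single when_def ring_homD[OF ring_hom_gl2_const]
         intro!: poly_mapping_eqI)
  thus ?thesis by simp
qed

lemma
  shows ring_hom_sym_coaction: "ring_hom (sym_coaction :: (2, 'a::comm_ring_1) mpol \<Rightarrow> _)"
    and sym_coaction_var: "sym_coaction (mpol_var i) = sym_incl (std_coaction (std_e i :: 2 \<Rightarrow>\<^sub>0 'a))"
    and sym_coaction_const: "sym_coaction (mpol_const (a :: 'a)) = mpol_const (gl2_const a)"
proof -
  have h: "ring_hom (\<lambda>a. mpol_const (gl2_const (a :: 'a)) :: (2, 'a gl2_ring) mpol)"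
    using ring_hom_mpol_const ring_hom_gl2_const unfolding ring_hom_def by metis
  show "ring_hom (sym_coaction :: (2, 'a) mpol \<Rightarrow> _)"
    unfolding sym_coaction_def by (rule ring_hom_mpol_eval[OF h])
  show "sym_coaction (mpol_var i) = sym_incl (std_coaction (std_e i :: 2 \<Rightarrow>\<^sub>0 'a))"
    unfolding sym_coaction_def by (rule mpol_eval_var[OF h])
  show "sym_coaction (mpol_const (a :: 'a)) = mpol_const (gl2_const a)"
    unfolding sym_coaction_def by (rule mpol_eval_const[OF h])
qed

text \<open>\<open>Sym\<^sup>d(V)\<close> is a subcomodule.\<close>

lemma sym_incl_in_sym_power: "sym_incl v \<in> sym_power 1"
  unfolding sym_incl_def mpol_const_def mpol_var_def mult_single
  by (intro sym_power_sum sym_power_single) (simp add: lookup_single when_def)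

theorem sym_coaction_sym_power:
  fixes w :: "(2, 'a::comm_ring_1) mpol"
  assumes "w \<in> sym_power d"
  shows "sym_coaction w \<in> sym_power d"
  unfolding sym_coaction_def mpol_eval_def
proof (rule sym_power_sum)
  fix m assume m: "m \<in> Poly_Mapping.keys w"
  have "(\<Prod>i\<in>UNIV. sym_incl (std_coaction (std_e i :: 2 \<Rightarrow>\<^sub>0 'a)) ^ Poly_Mapping.lookup m i) \<in>
      sym_power (\<Sum>i\<in>UNIV. Poly_Mapping.lookup m i * 1)"
    by (intro sym_power_prod sym_power_power sym_incl_in_sym_power) simp
  also have "(\<Sum>i\<in>UNIV. Poly_Mapping.lookup m i * 1) = d"
    using assms m by (simp add: sym_power_def)
  finally have "mpol_const (gl2_const (Poly_Mapping.lookup w m)) *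
      (\<Prod>i\<in>UNIV. sym_incl (std_coaction (std_e i :: 2 \<Rightarrow>\<^sub>0 'a)) ^ Poly_Mapping.lookup m i) \<in> sym_power (0 + d)"
    by (intro sym_power_mult) (simp_all add: mpol_const_def)
  thus "mpol_const (gl2_const (Poly_Mapping.lookup w m)) *
      (\<Prod>i\<in>UNIV. sym_incl (std_coaction (std_e i :: 2 \<Rightarrow>\<^sub>0 'a)) ^ Poly_Mapping.lookup m i) \<in> sym_power d"
    by simp
qed

section \<open>Weight spaces and characters\<close>

text \<open>
  Here \<open>W\<close> is a submodule of a free \<open>A\<close>-module \<open>F\<close>, and \<open>\<rho> : F \<rightarrow> k[T] \<otimes>\<^sub>A F\<close> restricts to a
  coaction on \<open>W\<close>. As \<open>k[T]\<close> is free over \<open>A\<close>, \<open>k[T] \<otimes>\<^sub>A W\<close> is a submodule of \<open>k[T] \<otimes>\<^sub>A F\<close>.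
\<close>

definition weight_space ::
    "(('b \<Rightarrow>\<^sub>0 'a::comm_ring_1) \<Rightarrow> ('b \<Rightarrow>\<^sub>0 'a torus_ring)) \<Rightarrow> ('b \<Rightarrow>\<^sub>0 'a) set \<Rightarrow> int \<times> int \<Rightarrow> ('b \<Rightarrow>\<^sub>0 'a) set"
  where "weight_space \<rho> W \<mu> = {w \<in> W. \<rho> w = pure_tensor torus_const (torus_char \<mu>) w}"

definition sum_of_free_weight_spaces ::
    "(('b \<Rightarrow>\<^sub>0 'a::comm_ring_1) \<Rightarrow> ('b \<Rightarrow>\<^sub>0 'a torus_ring)) \<Rightarrow> ('b \<Rightarrow>\<^sub>0 'a) set \<Rightarrow> bool"
  where "sum_of_free_weight_spaces \<rho> W \<longleftrightarrow>
    (\<forall>w\<in>W. \<exists>!f :: int \<times> int \<Rightarrow>\<^sub>0 ('b \<Rightarrow>\<^sub>0 'a).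
      (\<forall>\<mu>. Poly_Mapping.lookup f \<mu> \<in> weight_space \<rho> W \<mu>) \<and>
      w = (\<Sum>\<mu>\<in>Poly_Mapping.keys f. Poly_Mapping.lookup f \<mu>)) \<and>
    (\<forall>\<mu>. \<exists>n. free_of_rank (weight_space \<rho> W \<mu>) n)"

text \<open>
  Characters are elements of \<open>\<int>[x\<^sub>1\<^sup>\<plusminus>\<^sup>1, x\<^sub>2\<^sup>\<plusminus>\<^sup>1]\<close>. The definition is only meaningful if
  \<open>sum_of_free_weight_spaces \<rho> W\<close> holds and only finitely many weight spaces are nonzero.
\<close>

definition char_x1 :: "int \<times> int \<Rightarrow>\<^sub>0 int"
  where "char_x1 = Poly_Mapping.single (1, 0) 1"

definition char_x2 :: "int \<times> int \<Rightarrow>\<^sub>0 int"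
  where "char_x2 = Poly_Mapping.single (0, 1) 1"

definition character ::
    "(('b \<Rightarrow>\<^sub>0 'a::comm_ring_1) \<Rightarrow> ('b \<Rightarrow>\<^sub>0 'a torus_ring)) \<Rightarrow> ('b \<Rightarrow>\<^sub>0 'a) set \<Rightarrow> (int \<times> int \<Rightarrow>\<^sub>0 int)"
  where "character \<rho> W = (\<Sum>\<mu>\<in>{\<mu>. weight_space \<rho> W \<mu> \<noteq> {0}}.
    Poly_Mapping.single \<mu> (int (free_rank (weight_space \<rho> W \<mu>))))"

end

theory Submission
  imports Defs
begin

text \<open>
  Restricted to the torus, the coaction multiplies the monomial \<open>e\<^sub>1\<^sup>a e\<^sub>2\<^sup>b\<close> by the character
  \<open>t\<^sub>1\<^sup>a t\<^sub>2\<^sup>b\<close>. As distinct monomials have distinct characters, the nonzero weight spaces of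
  \<open>Sym\<^sup>d(V)\<close> are the lines spanned by the monomials of degree \<open>d\<close>, so that the character is
  the sum of all \<open>x\<^sub>1\<^sup>a x\<^sub>2\<^sup>b\<close> with \<open>a + b = d\<close>; pairing the exponents \<open>(a, b)\<close> and \<open>(b, a)\<close>
  gives the two formulas.
\<close>

section \<open>Monomials and coefficientwise ring homomorphisms\<close>

lemma prod_mpol_var_power:
  "(\<Prod>i\<in>UNIV. mpol_var i ^ Poly_Mapping.lookup m i) =
    (Poly_Mapping.single m 1 :: ('i::finite, 'r::comm_ring_1) mpol)"
proof -
  have power: "mpol_var i ^ n = (Poly_Mapping.single (Poly_Mapping.single i n) 1 :: ('i, 'r) mpol)" for i n
    by (induction n) (simp_all add: mpol_var_def mult_single flip: single_add)
  have "(\<Prod>i\<in>I. Poly_Mapping.single (g i) 1) = (Poly_Mapping.single (sum g I) 1 :: ('i, 'r) mpol)"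
    if "finite I" for g and I :: "'i set"
    using that by (induction I rule: finite_induct) (simp_all add: mult_single)
  moreover have "(\<Sum>i\<in>UNIV. Poly_Mapping.single i (Poly_Mapping.lookup m i)) = m"
    by (intro poly_mapping_eqI) (simp add: lookup_sum lookup_single when_def)
  ultimately show ?thesis by (simp add: power)
qed

text \<open>Evaluating at the variables themselves only changes coefficients. In this form
  \<open>ring_hom_mpol_eval\<close> applies, so the base change
  \<open>Poly_Mapping.map torus_restrict\<close> is seen to be multiplicative.\<close>

lemma map_eq_mpol_eval:
  fixes f :: "'r::comm_ring_1 \<Rightarrow> 's::comm_ring_1" and p :: "('i::finite, 'r) mpol"
  assumes "f 0 = 0"
  shows "Poly_Mapping.map f p = mpol_eval (\<lambda>a. mpol_const (f a)) mpol_var p"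
proof (rule poly_mapping_eqI)
  fix m
  show "Poly_Mapping.lookup (Poly_Mapping.map f p) m =
      Poly_Mapping.lookup (mpol_eval (\<lambda>a. mpol_const (f a)) mpol_var p) m"
    unfolding mpol_eval_def prod_mpol_var_power
    by (auto simp: lookup_map_0 assms mpol_const_def mult_single lookup_sum lookup_single when_def in_keys_iff)
qed

lemma ring_hom_compose: "ring_hom f \<Longrightarrow> ring_hom g \<Longrightarrow> ring_hom (\<lambda>x. g (f x))"
  by (simp add: ring_hom_def)

lemma ring_hom_map:
  fixes f :: "'r::comm_ring_1 \<Rightarrow> 's::comm_ring_1"
  assumes "ring_hom f"
  shows "ring_hom (Poly_Mapping.map f :: ('i::finite, 'r) mpol \<Rightarrow> ('i, 's) mpol)"
proof -
  have "f 0 = 0" by (rule ring_homD[OF assms])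
  hence "Poly_Mapping.map f = (mpol_eval (\<lambda>a. mpol_const (f a)) mpol_var :: ('i, 'r) mpol \<Rightarrow> _)"
    by (rule map_eq_mpol_eval[THEN ext])
  thus ?thesis
    using ring_hom_mpol_eval[OF ring_hom_compose[OF assms ring_hom_mpol_const]] by metis
qed

section \<open>The torus coaction is diagonal on monomials\<close>

lemma ring_hom_sym_torus_coaction: "ring_hom (sym_torus_coaction :: (2, 'a::comm_ring_1) mpol \<Rightarrow> _)"
  unfolding sym_torus_coaction_def
  by (rule ring_hom_compose[OF ring_hom_sym_coaction ring_hom_map[OF ring_hom_torus_restrict]])

lemma sym_torus_coaction_const:
  "sym_torus_coaction (mpol_const a) = mpol_const (torus_const (a :: 'a::comm_ring_1))"
  unfolding sym_torus_coaction_def sym_coaction_const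
  by (rule poly_mapping_eqI)
     (auto simp: mpol_const_def lookup_map_0 ring_homD[OF ring_hom_torus_restrict] lookup_single
       when_def torus_restrict_gl2)

text \<open>Restriction to the torus kills \<open>gl2_x 1 2\<close> and \<open>gl2_x 2 1\<close>, so
  of the two terms of the coaction on a basis vector only the diagonal one survives.\<close>

lemma sym_torus_coaction_var:
  "sym_torus_coaction (mpol_var i) =
    (mpol_const (torus_t i) * mpol_var i :: (2, 'a::comm_ring_1 torus_ring) mpol)"
  unfolding sym_torus_coaction_def sym_coaction_var std_coaction_std_e
proof (rule poly_mapping_eqI)
  fix m
  have "i = 1 \<or> i = 2" using UNIV_2 by blast
  thus "Poly_Mapping.lookup (Poly_Mapping.map torus_restrict (sym_incl
        (pure_tensor gl2_const (gl2_x i 1) (std_e 1) + pure_tensor gl2_const (gl2_x i 2) (std_e 2)))) m =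
      Poly_Mapping.lookup (mpol_const (torus_t i) * mpol_var i :: (2, 'a torus_ring) mpol) m"
    by (auto simp: sym_incl_def UNIV_2 std_e_def lookup_add lookup_pure_tensor
        ring_homD[OF ring_hom_gl2_const] lookup_single mpol_const_def mpol_var_def mult_single
        lookup_map_0 ring_homD[OF ring_hom_torus_restrict] torus_restrict_gl2 when_def)
qed

definition exponent_weight :: "(2 \<Rightarrow>\<^sub>0 nat) \<Rightarrow> int \<times> int"
  where "exponent_weight m = (int (Poly_Mapping.lookup m 1), int (Poly_Mapping.lookup m 2))"

text \<open>The index type \<open>2\<close> has only the elements 1 and 2, so both exponents
  together determine \<open>m\<close>. This is what limits every weight space to a single
  monomial.\<close>

lemma inj_exponent_weight: "inj exponent_weight"
proof (rule injI, rule poly_mapping_eqI)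
  fix m m' :: "2 \<Rightarrow>\<^sub>0 nat" and i :: 2
  assume "exponent_weight m = exponent_weight m'"
  moreover have "i = 1 \<or> i = 2" using UNIV_2 by blast
  ultimately show "Poly_Mapping.lookup m i = Poly_Mapping.lookup m' i"
    by (auto simp: exponent_weight_def)
qed

text \<open>The coaction is a ring homomorphism with known values on constants and variables; the
  factors \<open>torus_t i\<close> collect into the character of the monomial.\<close>

lemma sym_torus_coaction_single:
  "sym_torus_coaction (Poly_Mapping.single m a) =
    Poly_Mapping.single m (Poly_Mapping.single (exponent_weight m) (a :: 'a::comm_ring_1))"
proof -
  note hom = ring_homD[OF ring_hom_sym_torus_coaction] and const = ring_homD[OF ring_hom_mpol_const]
  \<comment> \<open>Stated for any coefficient ring, as it rewrites the left side over
    \<open>'a\<close> and the right side over \<open>'a torus_ring\<close>.\<close>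
  have mono: "Poly_Mapping.single m b =
      mpol_const b * (mpol_var 1 ^ Poly_Mapping.lookup m 1 * mpol_var 2 ^ Poly_Mapping.lookup m 2)"
    for b :: "'b::comm_ring_1"
    using prod_mpol_var_power[of m, where 'r = 'b]
    by (simp add: UNIV_2 mpol_const_def mult_single)
  have "Poly_Mapping.single (exponent_weight m) a =
      torus_const a * torus_t 1 ^ Poly_Mapping.lookup m 1 * torus_t 2 ^ Poly_Mapping.lookup m 2"
    by (simp add: torus_t_def torus_char_power torus_char_mult mult.assoc)
       (simp add: torus_const_def torus_char_def mult_single exponent_weight_def)
  thus ?thesis
    by (simp add: mono hom sym_torus_coaction_const sym_torus_coaction_var const power_mult_distrib mult_ac)
qed

lemma lookup_sym_torus_coaction:
  "Poly_Mapping.lookup (sym_torus_coaction w) m =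
    Poly_Mapping.single (exponent_weight m) (Poly_Mapping.lookup w m)"
  for w :: "(2, 'a::comm_ring_1) mpol"
proof -
  note hom = ring_homD[OF ring_hom_sym_torus_coaction]
  have "sym_torus_coaction (sum f I) = (\<Sum>i\<in>I. sym_torus_coaction (f i))"
    for f :: "_ \<Rightarrow> (2, 'a) mpol" and I :: "(2 \<Rightarrow>\<^sub>0 nat) set"
    by (induction I rule: infinite_finite_induct) (simp_all add: hom)
  hence "sym_torus_coaction w = (\<Sum>k\<in>Poly_Mapping.keys w.
      Poly_Mapping.single k (Poly_Mapping.single (exponent_weight k) (Poly_Mapping.lookup w k)))"
    by (subst poly_mapping_sum_single) (simp only: sym_torus_coaction_single)
  thus ?thesis
    by (simp add: lookup_sum lookup_single when_def in_keys_iff)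
qed

section \<open>Weight spaces and the weight decomposition\<close>

lemma weight_space_sym_power:
  "weight_space sym_torus_coaction (sym_power d :: (2, 'a::comm_ring_1) mpol set) \<mu> =
    {w \<in> sym_power d. \<forall>m\<in>Poly_Mapping.keys w. exponent_weight m = \<mu>}"
proof -
  \<comment> \<open>Distinct characters are linearly independent, so comparing coefficients at a key
    \<open>m\<close> of \<open>w\<close> leaves a condition on the weight of \<open>m\<close>
    alone.\<close>
  have single: "Poly_Mapping.single \<nu> c = Poly_Mapping.single \<mu> c \<longleftrightarrow> c = 0 \<or> \<nu> = \<mu>"
    for \<nu> and c :: 'a
    by (metis lookup_single_eq lookup_single_not_eq single_zero)
  have "sym_torus_coaction w = pure_tensor torus_const (torus_char \<mu>) w \<longleftrightarrow>
      (\<forall>m\<in>Poly_Mapping.keys w. exponent_weight m = \<mu>)" for w :: "(2, 'a) mpol"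
  proof -
    have "sym_torus_coaction w = pure_tensor torus_const (torus_char \<mu>) w \<longleftrightarrow>
        (\<forall>m. Poly_Mapping.lookup (sym_torus_coaction w) m =
          Poly_Mapping.lookup (pure_tensor torus_const (torus_char \<mu>) w) m)"
      by (auto intro: poly_mapping_eqI)
    also have "\<dots> \<longleftrightarrow> (\<forall>m. Poly_Mapping.single (exponent_weight m) (Poly_Mapping.lookup w m) =
        Poly_Mapping.single \<mu> (Poly_Mapping.lookup w m))"
      by (simp add: lookup_sym_torus_coaction lookup_pure_tensor ring_homD[OF ring_hom_torus_const]
          torus_char_def mult_single) (simp add: torus_const_def mult_single)
    finally show ?thesis by (auto simp: single in_keys_iff)
  qed
  thus ?thesis by (auto simp: weight_space_def)
qed

lemma sum_over_keys: "(\<Sum>k\<in>Poly_Mapping.keys f. Poly_Mapping.lookup f k) = (\<Sum>k\<in>K. Poly_Mapping.lookup f k)"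
  if "finite K" "Poly_Mapping.keys f \<subseteq> K"
  by (rule sum.mono_neutral_left) (use that in \<open>auto simp: in_keys_iff\<close>)

text \<open>One formula yields existence and uniqueness: the component at \<mu> must have the
  coefficient of \<open>w\<close> at each \<open>m\<close> of weight \<mu>, and zero
  elsewhere.\<close>

lemma sym_power_weight_decomposition:
  fixes w :: "(2, 'a::comm_ring_1) mpol"
  assumes w: "w \<in> sym_power d"
  shows "\<exists>!f :: int \<times> int \<Rightarrow>\<^sub>0 (2, 'a) mpol.
    (\<forall>\<mu>. Poly_Mapping.lookup f \<mu> \<in> weight_space sym_torus_coaction (sym_power d) \<mu>) \<and>
    w = (\<Sum>\<mu>\<in>Poly_Mapping.keys f. Poly_Mapping.lookup f \<mu>)" (is "\<exists>!f. ?P f")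
proof -
  have component: "Poly_Mapping.lookup (Poly_Mapping.lookup f \<mu>) m =
      (if \<mu> = exponent_weight m then Poly_Mapping.lookup w m else 0)" if f: "?P f" for f \<mu> m
  proof -
    have zero: "Poly_Mapping.lookup (Poly_Mapping.lookup f \<nu>) m = 0" if "\<nu> \<noteq> exponent_weight m" for \<nu>
    proof -
      have "Poly_Mapping.lookup f \<nu> \<in> weight_space sym_torus_coaction (sym_power d) \<nu>"
        using f[THEN conjunct1] by (rule spec)
      thus ?thesis using that by (auto simp: weight_space_sym_power in_keys_iff)
    qed
    \<comment> \<open>The weight of \<open>m\<close> need not be a key of \<open>f\<close>.
      Inserting it adds at most a zero summand, and afterwards the sum can be cut down to this one
      weight.\<close>
    have "Poly_Mapping.lookup w m =
        (\<Sum>\<nu>\<in>insert (exponent_weight m) (Poly_Mapping.keys f). Poly_Mapping.lookup (Poly_Mapping.lookup f \<nu>) m)"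
      using f sum_over_keys[of "insert (exponent_weight m) (Poly_Mapping.keys f)" f]
      by (simp add: lookup_sum subset_insertI del: sum.insert_if)
    also have "\<dots> = (\<Sum>\<nu>\<in>{exponent_weight m}. Poly_Mapping.lookup (Poly_Mapping.lookup f \<nu>) m)"
      by (rule sum.mono_neutral_right) (auto simp: zero)
    finally show ?thesis by (simp add: zero)
  qed
  \<comment> \<open>Existence: each term of \<open>w\<close> is filed under its own weight.\<close>
  define f where "f = (\<Sum>m\<in>Poly_Mapping.keys w.
    Poly_Mapping.single (exponent_weight m) (Poly_Mapping.single m (Poly_Mapping.lookup w m)))"
  have f: "Poly_Mapping.lookup (Poly_Mapping.lookup f \<mu>) m =
      (if \<mu> = exponent_weight m then Poly_Mapping.lookup w m else 0)" for \<mu> m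
  proof -
    have "Poly_Mapping.lookup (Poly_Mapping.lookup f \<mu>) m = (\<Sum>k\<in>Poly_Mapping.keys w.
        if k = m then if \<mu> = exponent_weight m then Poly_Mapping.lookup w m else 0 else 0)"
      unfolding f_def lookup_sum by (rule sum.cong) (auto simp: lookup_single when_def)
    thus ?thesis by (simp add: in_keys_iff)
  qed
  show ?thesis
  proof (rule ex1I[of _ f])
    \<comment> \<open>The components contain no monomial outside \<open>w\<close>, so they stay in
      degree \<open>d\<close>.\<close>
    have "Poly_Mapping.keys (Poly_Mapping.lookup f \<mu>) \<subseteq> Poly_Mapping.keys w" for \<mu>
      by (auto simp: in_keys_iff f split: if_splits)
    hence "Poly_Mapping.lookup f \<mu> \<in> weight_space sym_torus_coaction (sym_power d) \<mu>" for \<mu>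
      unfolding weight_space_sym_power
      using w by (auto simp: sym_power_def in_keys_iff f split: if_splits)
    moreover have "w = (\<Sum>\<mu>\<in>Poly_Mapping.keys f. Poly_Mapping.lookup f \<mu>)"
    proof (rule poly_mapping_eqI)
      fix m
      have "exponent_weight m \<in> Poly_Mapping.keys f" if "Poly_Mapping.lookup w m \<noteq> 0"
        using that f[of "exponent_weight m" m] by (auto simp: in_keys_iff)
      thus "Poly_Mapping.lookup w m =
          Poly_Mapping.lookup (\<Sum>\<mu>\<in>Poly_Mapping.keys f. Poly_Mapping.lookup f \<mu>) m"
        by (auto simp: lookup_sum f in_keys_iff[of _ f])
    qed
    ultimately show "?P f" by blast
    fix g assume "?P g"
    show "g = f"
      by (intro poly_mapping_eqI) (simp only: component[OF \<open>?P g\<close>] f)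
  qed
qed

section \<open>Ranks of the weight spaces\<close>

lemma free_of_rank_zero_iff: "free_of_rank ({0} :: ('b \<Rightarrow>\<^sub>0 'a::comm_ring_1) set) n \<longleftrightarrow> n = 0"
proof
  assume "free_of_rank ({0} :: ('b \<Rightarrow>\<^sub>0 'a) set) n"
  then obtain B :: "('b \<Rightarrow>\<^sub>0 'a) set" where B: "card B = n" "\<not> pm.dependent B" "pm.span B = {0}"
    by (auto simp: free_of_rank_def)
  have "B \<subseteq> {0}" using pm.span_superset[of B] B(3) by simp
  moreover have "0 \<notin> B" using pm.dependent_zero B(2) by blast
  ultimately show "n = 0" using B(1) by (cases "B = {}") auto
next
  assume "n = 0"
  thus "free_of_rank ({0} :: ('b \<Rightarrow>\<^sub>0 'a) set) n"
    unfolding free_of_rank_def by (intro exI[of _ "{}"]) (simp add: pm.independent_empty)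
qed

text \<open>Two distinct elements of a line over a commutative ring are always dependent, so a basis
  is a singleton. The uniqueness of the rank evaluates the \<open>THE\<close> in
  \<open>free_rank\<close>.\<close>

lemma free_of_rank_line_iff:
  "free_of_rank (range (Poly_Mapping.single m) :: ('b \<Rightarrow>\<^sub>0 'a::comm_ring_1) set) n \<longleftrightarrow> n = 1"
proof
  assume "free_of_rank (range (Poly_Mapping.single m) :: ('b \<Rightarrow>\<^sub>0 'a) set) n"
  then obtain B :: "('b \<Rightarrow>\<^sub>0 'a) set" where B: "finite B" "card B = n" "\<not> pm.dependent B"
    "pm.span B = range (Poly_Mapping.single m)"
    by (auto simp: free_of_rank_def)
  have "B \<noteq> {}"
  proof
    assume "B = {}"
    hence "Poly_Mapping.single m (1 :: 'a) = 0" using B(4) by auto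
    thus False by (metis lookup_single_eq lookup_zero zero_neq_one)
  qed
  moreover have "b = c" if bc: "b \<in> B" "c \<in> B" for b c
  proof (rule ccontr)
    assume "b \<noteq> c"
    obtain x y where xy: "b = Poly_Mapping.single m x" "c = Poly_Mapping.single m y"
      using bc pm.span_superset[of B] B(4) by blast
    \<comment> \<open>These coefficients give the relation \<open>y * x - x * y = 0\<close>.
      Independence then forces \<open>x\<close> and \<open>y\<close> to vanish, hence
      \<open>b = c\<close>.\<close>
    define u where "u v = (if v = b then y else - x)" for v
    have "(\<Sum>v\<in>{b, c}. pm_scale (u v) v) = 0"
      using \<open>b \<noteq> c\<close> by (auto intro!: poly_mapping_eqI simp: u_def xy lookup_add lookup_single when_def)
    hence "u v = 0" if "v \<in> {b, c}" for v
      using bc that by (intro pm.independentD[OF B(3), of "{b, c}"]) auto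
    from this[of b] this[of c] have "b = c" using \<open>b \<noteq> c\<close> by (auto simp: u_def xy)
    thus False using \<open>b \<noteq> c\<close> by simp
  qed
  ultimately show "n = 1"
    unfolding B(2)[symmetric] is_singleton_altdef[symmetric] by (rule is_singletonI')
next
  assume n: "n = 1"
  have "\<not> pm.dependent {Poly_Mapping.single m (1 :: 'a)}"
  proof
    assume "pm.dependent {Poly_Mapping.single m (1 :: 'a)}"
    then obtain u :: "('b \<Rightarrow>\<^sub>0 'a) \<Rightarrow> 'a"
      where "u (Poly_Mapping.single m 1) \<noteq> 0" "pm_scale (u (Poly_Mapping.single m 1)) (Poly_Mapping.single m 1) = 0"
      by (subst (asm) pm.dependent_finite) auto
    thus False by (metis lookup_pm_scale lookup_single_eq lookup_zero mult_1_right)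
  qed
  moreover have "pm.span {Poly_Mapping.single m (1 :: 'a)} = range (Poly_Mapping.single m)"
    by (simp add: pm.span_singleton pm_scale_def)
  ultimately show "free_of_rank (range (Poly_Mapping.single m) :: ('b \<Rightarrow>\<^sub>0 'a) set) n"
    unfolding free_of_rank_def n by (intro exI[of _ "{Poly_Mapping.single m 1}"]) simp
qed

text \<open>By injectivity of \<open>exponent_weight\<close>, no monomial other than
  \<open>m\<close> can occur in an element of this weight.\<close>

lemma weight_space_exponent_weight:
  assumes "(\<Sum>i\<in>UNIV. Poly_Mapping.lookup m i) = d"
  shows "weight_space sym_torus_coaction (sym_power d) (exponent_weight m) =
    range (Poly_Mapping.single m :: 'a::comm_ring_1 \<Rightarrow> _)"
proof -
  have "w = Poly_Mapping.single m (Poly_Mapping.lookup w m)"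
    if "\<forall>k\<in>Poly_Mapping.keys w. exponent_weight k = exponent_weight m" for w :: "(2, 'a) mpol"
    using that
    by (intro poly_mapping_eqI) (auto simp: inj_eq[OF inj_exponent_weight] lookup_single when_def in_keys_iff)
  thus ?thesis using assms
    by (auto simp: weight_space_sym_power split: if_splits)
qed

lemma weight_space_eq_0:
  assumes "\<And>m. (\<Sum>i\<in>UNIV. Poly_Mapping.lookup m i) = d \<Longrightarrow> exponent_weight m \<noteq> \<mu>"
  shows "weight_space sym_torus_coaction (sym_power d) \<mu> = {0 :: (2, 'a::comm_ring_1) mpol}"
proof -
  have "Poly_Mapping.keys w = {}"
    if "w \<in> weight_space sym_torus_coaction (sym_power d) \<mu>" for w :: "(2, 'a) mpol"
    using that[unfolded weight_space_sym_power] assms by (fastforce simp: sym_power_def)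
  thus ?thesis by (auto simp: weight_space_sym_power)
qed

lemma sum_of_free_weight_spaces_sym_power:
  "sum_of_free_weight_spaces sym_torus_coaction (sym_power d :: (2, 'a::comm_ring_1) mpol set)"
proof -
  \<comment> \<open>A weight either comes from a monomial of degree \<open>d\<close>, giving rank 1,
    or from none, giving rank 0.\<close>
  have "\<exists>n. free_of_rank (weight_space sym_torus_coaction (sym_power d :: (2, 'a) mpol set) \<mu>) n" for \<mu>
    using weight_space_exponent_weight[where 'a = 'a] weight_space_eq_0[where 'a = 'a]
      free_of_rank_line_iff free_of_rank_zero_iff by metis
  thus ?thesis
    unfolding sum_of_free_weight_spaces_def using sym_power_weight_decomposition by blast
qed

section \<open>The character as a sum over all monomials\<close>

lemma character_sym_power:
  "character sym_torus_coaction (sym_power d :: (2, 'a::comm_ring_1) mpol set) =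
    (\<Sum>i\<le>d. char_x1 ^ (d - i) * char_x2 ^ i)"
proof -
  let ?W = "weight_space sym_torus_coaction (sym_power d :: (2, 'a) mpol set)"
  \<comment> \<open>The weight of the monomial whose second exponent is \<open>i\<close>. The
    subtraction is truncated, so this is only right for \<open>i \<le> d\<close>.\<close>
  define \<mu> where "\<mu> i = (int (d - i), int i)" for i
  have W: "\<exists>m. ?W (\<mu> i) = range (Poly_Mapping.single m)" if "i \<le> d" for i
  proof -
    define m :: "2 \<Rightarrow>\<^sub>0 nat" where "m = Poly_Mapping.single 1 (d - i) + Poly_Mapping.single 2 i"
    have "exponent_weight m = \<mu> i" "(\<Sum>i\<in>UNIV. Poly_Mapping.lookup m i) = d"
      using that by (simp_all add: exponent_weight_def \<mu>_def m_def lookup_add lookup_single UNIV_2)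
    thus ?thesis using weight_space_exponent_weight by metis
  qed
  have single_1: "range (Poly_Mapping.single m :: 'a \<Rightarrow> _) \<noteq> {0}" for m :: "2 \<Rightarrow>\<^sub>0 nat"
  proof
    assume "range (Poly_Mapping.single m :: 'a \<Rightarrow> _) = {0}"
    hence "Poly_Mapping.single m (1 :: 'a) = 0" by blast
    thus False by (metis lookup_single_eq lookup_zero zero_neq_one)
  qed
  have "\<nu> \<in> \<mu> ` {..d}" if "?W \<nu> \<noteq> {0}" for \<nu>
  proof -
    obtain m where "(\<Sum>i\<in>UNIV. Poly_Mapping.lookup m i) = d" "exponent_weight m = \<nu>"
      using \<open>?W \<nu> \<noteq> {0}\<close> weight_space_eq_0 by blast
    thus ?thesis
      by (intro image_eqI[of _ _ "Poly_Mapping.lookup m 2"]) (auto simp: UNIV_2 exponent_weight_def \<mu>_def)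
  qed
  hence support: "{\<nu>. ?W \<nu> \<noteq> {0}} = \<mu> ` {..d}"
    using W single_1 by fastforce
  have "inj_on \<mu> {..d}" by (auto simp: inj_on_def \<mu>_def)
  hence "character sym_torus_coaction (sym_power d :: (2, 'a) mpol set) =
      (\<Sum>i\<le>d. Poly_Mapping.single (\<mu> i) (int (free_rank (?W (\<mu> i)))))"
    unfolding character_def support by (simp add: sum.reindex)
  also have "\<dots> = (\<Sum>i\<le>d. Poly_Mapping.single (\<mu> i) 1)"
  proof (rule sum.cong[OF refl])
    fix i assume "i \<in> {..d}"
    hence "i \<le> d" by simp
    then obtain m where "?W (\<mu> i) = range (Poly_Mapping.single m)" by (rule W[THEN exE])
    thus "Poly_Mapping.single (\<mu> i) (int (free_rank (?W (\<mu> i)))) = Poly_Mapping.single (\<mu> i) 1"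
      by (simp add: free_rank_def free_of_rank_line_iff)
  qed
  also have "\<dots> = (\<Sum>i\<le>d. char_x1 ^ (d - i) * char_x2 ^ i)"
  proof (rule sum.cong[OF refl])
    fix i assume "i \<in> {..d}"
    \<comment> \<open>Characters live in the torus ring over the integers, so the laws of
      \<open>torus_char\<close> also compute powers of the formal variables.\<close>
    have x: "char_x1 = torus_char (1, 0)" "char_x2 = torus_char (0, 1)"
      by (simp_all add: char_x1_def char_x2_def torus_char_def)
    have "char_x1 ^ (d - i) * char_x2 ^ i = torus_char (\<mu> i)"
      unfolding x torus_char_power torus_char_mult by (simp add: \<mu>_def)
    thus "Poly_Mapping.single (\<mu> i) 1 = char_x1 ^ (d - i) * char_x2 ^ i"
      by (simp add: torus_char_def)
  qed
  finally show ?thesis .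
qed

section \<open>Pairing the terms by reflection\<close>

lemma sum_fold_odd:
  fixes f :: "nat \<Rightarrow> 'b::comm_monoid_add"
  shows "sum f {..2 * k + 1} = (\<Sum>i=0..k. f i + f (2 * k + 1 - i))"
proof -
  have "(\<Sum>i=0..k. f (2 * k + 1 - i)) = sum f {k+1..2 * k + 1}"
    \<comment> \<open>The reflection is its own inverse and carries the lower half of the indices
      onto the upper half.\<close>
    by (rule sum.reindex_bij_witness[of _ "\<lambda>i. 2 * k + 1 - i" "\<lambda>i. 2 * k + 1 - i"]) auto
  moreover have "{..2 * k + 1} = {0..k} \<union> {k+1..2 * k + 1}" by auto
  ultimately show ?thesis by (simp add: sum.union_disjoint sum.distrib del: atMost_Suc)
qed

text \<open>The reflection fixes the middle index \<open>k\<close>, which stays unpaired. For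
  \<open>k = 0\<close> the truncated range \<open>{0..k-1}\<close> would be \<open>{0..0}\<close>
  instead of empty, whence \<open>k \<ge> 1\<close>.\<close>

lemma sum_fold_even:
  fixes f :: "nat \<Rightarrow> 'b::comm_monoid_add"
  assumes "k \<ge> 1"
  shows "sum f {..2 * k} = f k + (\<Sum>i=0..k-1. f i + f (2 * k - i))"
proof -
  have "(\<Sum>i=0..k-1. f (2 * k - i)) = sum f {k+1..2 * k}"
    by (rule sum.reindex_bij_witness[of _ "\<lambda>i. 2 * k - i" "\<lambda>i. 2 * k - i"]) (use assms in auto)
  moreover have "{..2 * k} = insert k ({0..k-1} \<union> {k+1..2 * k})" using assms by auto
  moreover have "k \<notin> {0..k-1} \<union> {k+1..2 * k}" using assms by auto
  ultimately show ?thesis by (simp add: sum.union_disjoint sum.distrib)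
qed

theorem corollary6p5:
  shows "(\<forall>k d. d = 2 * k + 1 \<longrightarrow>
      sum_of_free_weight_spaces sym_torus_coaction (sym_power d :: (2, 'a::comm_ring_1) mpol set) \<and>
      character sym_torus_coaction (sym_power d :: (2, 'a) mpol set) =
        (\<Sum>i=0..k. char_x2 ^ i * char_x1 ^ (d - i) + char_x2 ^ (d - i) * char_x1 ^ i)) \<and>
    (\<forall>k d. d = 2 * k \<and> d \<ge> 2 \<longrightarrow>
      sum_of_free_weight_spaces sym_torus_coaction (sym_power d :: (2, 'a) mpol set) \<and>
      character sym_torus_coaction (sym_power d :: (2, 'a) mpol set) =
        char_x1 ^ k * char_x2 ^ k +
        (\<Sum>i=0..k-1. char_x1 ^ (d - i) * char_x2 ^ i + char_x1 ^ i * char_x2 ^ (d - i)))"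
proof (intro conjI allI impI)
  fix k d :: nat
  \<comment> \<open>This goal arises once for each parity, in the same form.\<close>
  show "sum_of_free_weight_spaces sym_torus_coaction (sym_power d :: (2, 'a) mpol set)"
    "sum_of_free_weight_spaces sym_torus_coaction (sym_power d :: (2, 'a) mpol set)"
    by (rule sum_of_free_weight_spaces_sym_power)+
  show "character sym_torus_coaction (sym_power d :: (2, 'a) mpol set) =
      (\<Sum>i=0..k. char_x2 ^ i * char_x1 ^ (d - i) + char_x2 ^ (d - i) * char_x1 ^ i)"
    if d: "d = 2 * k + 1"
    unfolding character_sym_power d sum_fold_odd
    by (rule sum.cong) (auto simp: mult.commute)
  show "character sym_torus_coaction (sym_power d :: (2, 'a) mpol set) =
      char_x1 ^ k * char_x2 ^ k +
      (\<Sum>i=0..k-1. char_x1 ^ (d - i) * char_x2 ^ i + char_x1 ^ i * char_x2 ^ (d - i))"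
    if d: "d = 2 * k \<and> d \<ge> 2"
  proof -
    have "k \<ge> 1" and d: "d = 2 * k" using d by auto
    show ?thesis
      \<comment> \<open>What remains is \<open>2 * k - k = k\<close> in the middle term and
        \<open>2 * k - (2 * k - i) = i\<close> in the reflected ones.\<close>
      unfolding character_sym_power d sum_fold_even[OF \<open>k \<ge> 1\<close>]
      by (intro arg_cong2[of _ _ _ _ "(+)"] sum.cong) auto
  qed
qed

end
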